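(* For every prime power $q$, an ${\rm O}^+(8,q)$-space has a maximal orthogonal partial spread $\Sigma$ of size $2q^2+1$. If $q$ is even, then $\Sigma$ is a maximal symplectic partial spread.
   Context: An ${\rm O}^+(8,q)$-space is an $8$-dimensional $\mathbb{F}_q$-space with a nondegenerate quadratic form $Q$ of plus type; for $q$ even its polar form $f(u,v)=Q(u+v)-Q(u)-Q(v)$ is nondegenerate alternating. An orthogonal (resp. symplectic) partial spread is a set of $4$-dimensional subspaces on which $Q$ (resp. $f$) vanishes, pairwise meeting only in $0$; maximal means not properly contained in another such. *)

theory Defs
  imports "HOL-Number_Theory.Prime_Powers" "HOL-Library.Cardinality"
begin

definition polar :: "('v::ab_group_add \<Rightarrow> 'k::ab_group_add) \<Rightarrow> 'v \<Rightarrow> 'v \<Rightarrow> 'k" where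
  "polar Q u v = Q (u + v) - Q u - Q v"

(* The polar form is symmetric by definition, so linearity in the second argument
   already says that it is bilinear. *)
locale quadratic_space = vector_space scale
  for scale :: "'k::field \<Rightarrow> 'v::ab_group_add \<Rightarrow> 'v" (infixr \<open>*s\<close> 75) +
  fixes Q :: "'v \<Rightarrow> 'k"
  assumes Q_scale: "Q (c *s v) = c\<^sup>2 * Q v"
    and polar_linear: "Vector_Spaces.linear scale (*) (polar Q u)"
begin

definition totally_singular :: "'v set \<Rightarrow> bool" where
  "totally_singular U \<longleftrightarrow> subspace U \<and> (\<forall>u\<in>U. Q u = 0)"

(* Nondegeneracy in arbitrary characteristic: the radical of the polar form contains
   no nonzero singular vector.  If the characteristic is odd, this says
   that the polar form is nondegenerate. *)
definition nondegenerate :: bool where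
  "nondegenerate \<longleftrightarrow> (\<forall>v. Q v = 0 \<and> (\<forall>w. polar Q v w = 0) \<longrightarrow> v = 0)"

(* Only meaningful on a finite-dimensional space, where the set of dimensions is finite. *)
definition witt_index :: nat where
  "witt_index = Max {dim U | U. totally_singular U}"

end

(* Plus type: the Witt index is half the dimension.  Since dim is 0 on
   infinite-dimensional spaces, dim UNIV = 8 includes finite-dimensionality. *)
locale O_plus_8_space = quadratic_space scale Q
  for scale :: "'k::field \<Rightarrow> 'v::ab_group_add \<Rightarrow> 'v" (infixr \<open>*s\<close> 75) and Q +
  assumes dim_8: "dim UNIV = 8"
    and nondegenerate: nondegenerate
    and plus_type: "witt_index = 4"
begin

definition orthogonal_partial_spread :: "'v set set \<Rightarrow> bool" where
  "orthogonal_partial_spread S \<longleftrightarrow>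
     (\<forall>U\<in>S. subspace U \<and> dim U = 4 \<and> (\<forall>u\<in>U. Q u = 0)) \<and>
     pairwise (\<lambda>U W. U \<inter> W = {0}) S"

definition symplectic_partial_spread :: "'v set set \<Rightarrow> bool" where
  "symplectic_partial_spread S \<longleftrightarrow>
     (\<forall>U\<in>S. subspace U \<and> dim U = 4 \<and> (\<forall>u\<in>U. \<forall>v\<in>U. polar Q u v = 0)) \<and>
     pairwise (\<lambda>U W. U \<inter> W = {0}) S"

definition maximal_orthogonal_partial_spread :: "'v set set \<Rightarrow> bool" where
  "maximal_orthogonal_partial_spread S \<longleftrightarrow>
     orthogonal_partial_spread S \<and> (\<nexists>T. orthogonal_partial_spread T \<and> S \<subset> T)"

definition maximal_symplectic_partial_spread :: "'v set set \<Rightarrow> bool" where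
  "maximal_symplectic_partial_spread S \<longleftrightarrow>
     symplectic_partial_spread S \<and> (\<nexists>T. symplectic_partial_spread T \<and> S \<subset> T)"

end

end

theory Submission
  imports Defs "HOL-Analysis.Cartesian_Space"
begin

text \<open>Under triality a partial spread becomes a set of pairwise non-perpendicular singular points.  Split
  the space as \<open>V \<oplus> D\<close>, with \<open>V\<close> and \<open>D\<close> perpendicular and both of type \<open>O\<^sup>-(4, q)\<close>, fix a point \<open>p\<close> of the
  elliptic quadric of \<open>V\<close>, and replace \<open>p\<close> by the points \<open>p + d\<close>, with \<open>d\<close> running over representatives
  of the points of the elliptic quadric of \<open>D\<close>.  This set has size \<open>q\<^sup>2 + (q\<^sup>2 + 1)\<close>, and every singular
  point is perpendicular to one of its members.  Here triality is avoided by
  using coordinates: with respect to a hyperbolic frame, the totally singular 4-spaces disjoint from one of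
  them are the graphs of alternating matrices of order 4, and two graphs meet trivially iff the Pfaffian
  of the difference is nonzero.  Maximality for symplectic partial spreads follows because singular
  alternating matrices have kernels of even dimension.\<close>

section \<open>An anisotropic binary form over a finite field\<close>

text \<open>On a finite field \<open>t^2 + t\<close> takes the value 0 at both 0 and -1, so it
  misses some \<open>d\<close>; then \<open>c = - d\<close>. This covers every characteristic at
  once.\<close>

lemma finite_field_ex_irreducible_quadratic: "\<exists>c::'k::{field,finite}. \<forall>t. t\<^sup>2 + t + c \<noteq> 0"
proof -
  have "\<not> inj (\<lambda>t::'k. t\<^sup>2 + t)"
    by (rule notI, drule injD[of _ 0 "-1"]) auto
  then have "\<not> surj (\<lambda>t::'k. t\<^sup>2 + t)"
    using finite_UNIV_surj_inj finite by blast
  then obtain d :: 'k where "\<forall>t. t\<^sup>2 + t \<noteq> d"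
    unfolding surj_def by metis
  then show ?thesis
    by (intro exI[of _ "- d"]) auto
qed

text \<open>Fibres have at most two elements, and the one over \<open>k\<close> is just
  \<open>{0}\<close>; that fibre gains the strict inequality, which later forces two such images to
  meet.\<close>

lemma card_square_image:
  fixes d :: "'k::{field,finite}"
  assumes "d \<noteq> 0"
  shows "CARD('k) < 2 * card (range (\<lambda>s. k - d * s\<^sup>2))"
proof -
  let ?g = "\<lambda>s. k - d * s\<^sup>2"
  have fib: "card {s. ?g s = ?g t} \<le> 2" for t
  proof -
    have "{s. ?g s = ?g t} \<subseteq> {t, - t}"
      using assms by (auto simp: power2_eq_iff)
    then have "card {s. ?g s = ?g t} \<le> card {t, - t}"
      by (intro card_mono) auto
    also have "\<dots> \<le> 2" by (simp add: card_insert_if)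
    finally show ?thesis .
  qed
  have "CARD('k) = (\<Sum>z\<in>range ?g. card {s. ?g s = z})"
    using sum.group[of UNIV "range ?g" ?g "\<lambda>_. 1::nat"] by simp
  also have "\<dots> = card {s. ?g s = k} + (\<Sum>z\<in>range ?g - {k}. card {s. ?g s = z})"
    by (rule sum.remove) (auto intro: image_eqI[of _ _ 0])
  also have "{s. ?g s = k} = {0}"
    using assms by auto
  also have "(\<Sum>z\<in>range ?g - {k}. card {s. ?g s = z}) \<le> (\<Sum>z\<in>range ?g - {k}. 2)"
    by (rule sum_mono) (use fib in auto)
  also have "\<dots> = 2 * card (range ?g) - 2"
    by (subst sum_constant, subst card_Diff_singleton) (auto intro: image_eqI[of _ _ 0])
  finally have "CARD('k) \<le> 1 + (2 * card (range ?g) - 2)" by simp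
  moreover have "card (range ?g) > 0"
    by (simp add: card_gt_0_iff)
  ultimately show ?thesis by linarith
qed

text \<open>In characteristic two \<open>x = - x\<close>, so squaring is injective, hence onto a
  finite field.\<close>

lemma finite_field_square_char_2:
  fixes a :: "'k::{field,finite}"
  assumes "(2::'k) = 0"
  obtains d where "d\<^sup>2 = a"
proof -
  have "inj (\<lambda>x::'k. x\<^sup>2)"
  proof (rule injI)
    fix x y :: 'k
    assume "x\<^sup>2 = y\<^sup>2"
    then have "x = y \<or> x = - y" by (simp add: power2_eq_iff)
    moreover have "- y = y"
      using assms by (metis add_eq_0_iff mult_2 mult_zero_left)
    ultimately show "x = y" by auto
  qed
  then have "surj (\<lambda>x::'k. x\<^sup>2)"
    using finite_UNIV_inj_surj finite by blast
  then show ?thesis using that by (metis surjD)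
qed

lemma two_eq_0_of_even_card:
  assumes "primepow CARD('k)" "even CARD('k)"
  shows "(2::'k::{field,finite}) = 0"
proof -
  obtain p n where p: "prime p" "CARD('k) = p ^ n"
    using assms(1) by (auto simp: primepow_def)
  then have "p = 2"
    using assms(2) by (metis even_power primes_dvd_imp_eq two_is_prime_nat)
  moreover have "(of_nat CARD('k) :: 'k) = 0"
  proof -
    \<comment> \<open>Translation by 1 permutes the field, so it preserves the sum of all
      elements.\<close>
    have "(\<Sum>x\<in>UNIV. x) = (\<Sum>x\<in>UNIV. x + 1 :: 'k)"
      by (rule sum.reindex_bij_witness[of _ "\<lambda>x. x + 1" "\<lambda>x. x - 1"]) auto
    then show ?thesis by (simp add: sum.distrib)
  qed
  ultimately show ?thesis
    using p by (simp add: of_nat_power)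
qed

locale anisotropic_form =
  fixes c :: "'k::{field,finite}"
  assumes no_root: "t\<^sup>2 + t + c \<noteq> 0"
begin

text \<open>The norm of \<open>x + y w\<close> from the quadratic extension, \<open>w\<close> being
  a root of \<open>T^2 - T + c\<close>.\<close>

definition N :: "'k \<Rightarrow> 'k \<Rightarrow> 'k" where
  "N x y = x\<^sup>2 + x * y + c * y\<^sup>2"

lemma N_eq_0_iff: "N x y = 0 \<longleftrightarrow> x = 0 \<and> y = 0"
proof (cases "y = 0")
  case False
  have "N x y = y\<^sup>2 * ((x / y)\<^sup>2 + x / y + c)"
    using False by (simp add: N_def field_simps power2_eq_square)
  then show ?thesis
    using False no_root by simp
qed (simp add: N_def)

lemma c_nonzero: "c \<noteq> 0"
  using no_root[of 0] by simp

text \<open>Up to sign this is the discriminant of \<open>t^2 + t + c\<close>: if it vanished, 2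
  would be invertible and \<open>- 1 / 2\<close> a double root.\<close>

lemma disc_nonzero: "4 * c - 1 \<noteq> 0"
proof
  assume 1: "4 * c - 1 = 0"
  then have 2: "(2::'k) \<noteq> 0"
  proof -
    have "(2::'k) * (2 * c) = 1" using 1 by (simp add: algebra_simps)
    then show ?thesis by (metis mult_zero_left zero_neq_one)
  qed
  define t :: 'k where "t = - 1 / 2"
  then have t: "2 * t = - 1" using 2 by simp
  have "2 * 2 * (t\<^sup>2 + t + c) = (2 * t)\<^sup>2 + 2 * (2 * t) + 4 * c"
    by (simp add: power2_eq_square algebra_simps)
  also have "\<dots> = 0"
    using 1 unfolding t by (simp add: algebra_simps)
  finally show False
    using 2 no_root[of t] by (metis mult_eq_0_iff)
qed

text \<open>In characteristic two \<open>y = 0\<close> suffices, as all elements are squares.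
  Otherwise \<open>4 * N x y = (2 * x + y)^2 + (4 * c - 1) * y^2\<close>; the squares and the values
  \<open>4 * k - (4 * c - 1) * y^2\<close> each fill more than half of the field, so they
  meet.\<close>

lemma N_surj: obtains x y where "N x y = k"
proof (cases "(2::'k) = 0")
  case True
  then obtain d where "d\<^sup>2 = k"
    by (rule finite_field_square_char_2)
  then show ?thesis
    using that[of d 0] by (simp add: N_def)
next
  case False
  let ?S = "range (\<lambda>s::'k. 0 - (- 1) * s\<^sup>2)"
  let ?T = "range (\<lambda>s::'k. 4 * k - (4 * c - 1) * s\<^sup>2)"
  have "?S \<inter> ?T \<noteq> {}"
  proof
    assume "?S \<inter> ?T = {}"
    then have "card ?S + card ?T = card (?S \<union> ?T)"
      by (subst card_Un_disjoint) auto
    also have "\<dots> \<le> CARD('k)"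
      by (rule card_mono) auto
    finally show False
      using card_square_image[of "- 1 :: 'k" 0] card_square_image[OF disc_nonzero, of "4 * k"]
      by (simp del: range_eqI)
  qed
  then obtain s y where sy: "s\<^sup>2 = 4 * k - (4 * c - 1) * y\<^sup>2"
    by auto
  have 4: "(4::'k) \<noteq> 0"
    using False by (metis mult_2 mult_eq_0_iff numeral_Bit0)
  define x where "x = (s - y) / 2"
  then have x: "2 * x = s - y" using False by (metis nonzero_mult_div_cancel_left times_divide_eq_right)
  have "4 * N x y = (2 * x)\<^sup>2 + 2 * (2 * x) * y + 4 * c * y\<^sup>2"
    by (simp add: N_def algebra_simps power2_eq_square)
  also have "\<dots> = 4 * k"
    using sy unfolding x by (simp add: power2_eq_square algebra_simps)
  finally show ?thesis
    using that 4 by (metis mult_left_cancel)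
qed

text \<open>For a nonzero value, one of the reflections in \<open>(1, 0)\<close> and \<open>(0, 1)\<close> moves a given
  representation, since the polar form of \<open>N\<close> is nondegenerate.\<close>
lemma N_surj_avoiding:
  assumes "k \<noteq> 0 \<or> a \<noteq> 0 \<or> b \<noteq> 0"
  obtains x y where "N x y = k" "x \<noteq> a \<or> y \<noteq> b"
proof (cases "k = 0")
  case True
  then show ?thesis using assms that[of 0 0] N_eq_0_iff by auto
next
  case False
  obtain x y where xy: "N x y = k" using N_surj .
  have 1: "N (- x - y) y = k"
    using xy by (simp add: N_def power2_eq_square algebra_simps)
  have 2: "N x (- y - x / c) = k"
  proof -
    define z where "z = x / c"
    then have "x = c * z" using c_nonzero by simp
    then show ?thesis
      using xy unfolding z_def[symmetric] by (simp add: N_def power2_eq_square algebra_simps)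
  qed
  \<comment> \<open>A pair fixed by both reflections satisfies \<open>2 * x + y = 0\<close> and
    \<open>x + 2 * c * y = 0\<close>, a system of determinant \<open>4 * c - 1\<close>. So two of
    the three representations differ, and one of them avoids \<open>(a, b)\<close>.\<close>
  have "\<not> (- x - y = x \<and> - y - x / c = y)"
  proof
    assume "- x - y = x \<and> - y - x / c = y"
    then have y: "y = - 2 * x" and "x / c = - 2 * y"
      by (simp_all add: algebra_simps eq_neg_iff_add_eq_0)
    then have x: "x = - 2 * c * y"
      using c_nonzero by (simp add: field_simps)
    have "(4 * c - 1) * x = 0"
      using x unfolding y by (simp add: algebra_simps)
    then have "x = 0" "y = 0" using y disc_nonzero by auto
    then show False using xy False N_eq_0_iff by auto
  qed
  then show ?thesis
    using that xy 1 2 by metis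
qed

end

section \<open>Alternating matrices of order four\<close>

definition dot :: "'k::comm_ring_1^'n \<Rightarrow> 'k^'n \<Rightarrow> 'k" where
  "dot x y = (\<Sum>i\<in>UNIV. x$i * y$i)"

lemma dot_commute: "dot x y = dot y x"
  by (simp add: dot_def mult.commute)

lemma dot_add_left: "dot (x + y) z = dot x z + dot y z"
  by (simp add: dot_def sum.distrib distrib_right)

lemma dot_add_right: "dot z (x + y) = dot z x + dot z y"
  by (simp add: dot_def sum.distrib distrib_left)

lemma dot_scale_right: "dot z (c *s x) = c * dot z x"
  by (simp add: dot_def sum_distrib_left mult.left_commute)

lemma dot_diff_right: "dot z (x - y) = dot z x - dot z y"
  by (simp add: dot_def sum_subtractf right_diff_distrib)

lemma dot_axis: "dot x (axis i 1) = x$i"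
  by (simp add: dot_def axis_def if_distrib cong: if_cong)

lemma dot_zero: "dot x 0 = 0" "dot 0 x = 0"
  by (simp_all add: dot_def)

definition alternating :: "'k::comm_ring_1^'n^'n \<Rightarrow> bool" where
  "alternating M \<longleftrightarrow> (\<forall>i. M$i$i = 0) \<and> (\<forall>i j. M$i$j = - M$j$i)"

definition skew :: "'k \<Rightarrow> 'k \<Rightarrow> 'k \<Rightarrow> 'k \<Rightarrow> 'k \<Rightarrow> 'k \<Rightarrow> 'k::comm_ring_1^4^4" where
  "skew a b c d e f = vector [vector [0, a, b, c], vector [-a, 0, d, e],
                              vector [-b, -d, 0, f], vector [-c, -e, -f, 0]]"

definition Pf :: "'k::comm_ring_1^4^4 \<Rightarrow> 'k" where
  "Pf M = M$1$2 * M$3$4 - M$1$3 * M$2$4 + M$1$4 * M$2$3"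

text \<open>The Pfaffian adjugate: complementary entries are exchanged up to sign, as by the Hodge
  star on bivectors.\<close>

definition pf_dual :: "'k::comm_ring_1^4^4 \<Rightarrow> 'k^4^4" where
  "pf_dual M = skew (M$3$4) (- M$2$4) (M$2$3) (M$1$4) (- M$1$3) (M$1$2)"

lemma vector_4_nth:
  "(vector [a, b, c, d] :: 'k::zero^4)$1 = a"
  "(vector [a, b, c, d] :: 'k::zero^4)$2 = b"
  "(vector [a, b, c, d] :: 'k::zero^4)$3 = c"
  "(vector [a, b, c, d] :: 'k::zero^4)$4 = d"
  by (simp_all add: vector_def)

lemma alternating_skew: "alternating (skew a b c d e f)"
  by (simp add: alternating_def skew_def forall_4 vector_4_nth)

lemma alternatingE:
  fixes M :: "'k::comm_ring_1^4^4"
  assumes "alternating M"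
  obtains a b c d e f where "M = skew a b c d e f"
proof
  have "M$2$1 = - M$1$2" "M$3$1 = - M$1$3" "M$4$1 = - M$1$4"
    "M$3$2 = - M$2$3" "M$4$2 = - M$2$4" "M$4$3 = - M$3$4" "\<And>i. M$i$i = 0"
    using assms unfolding alternating_def by blast+
  then show "M = skew (M$1$2) (M$1$3) (M$1$4) (M$2$3) (M$2$4) (M$3$4)"
    unfolding skew_def vec_eq_iff forall_4 by (simp add: vector_4_nth)
qed

lemma alternating_diff:
  assumes "alternating M" "alternating M'"
  shows "alternating (M - M')"
proof -
  have "(M - M')$i$j = - (M - M')$j$i" "(M - M')$i$i = 0" for i j
  proof -
    have "M$i$j = - M$j$i" "M'$i$j = - M'$j$i" "M$i$i = 0" "M'$i$i = 0"
      using assms unfolding alternating_def by blast+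
    then show "(M - M')$i$j = - (M - M')$j$i" "(M - M')$i$i = 0" by simp_all
  qed
  then show ?thesis
    unfolding alternating_def by blast
qed

lemma skew_mult:
  "skew a b c d e f *v x = vector [a * x$2 + b * x$3 + c * x$4, - a * x$1 + d * x$3 + e * x$4,
     - b * x$1 - d * x$2 + f * x$4, - c * x$1 - e * x$2 - f * x$3]"
  by (simp add: matrix_vector_mult_def vec_eq_iff forall_4 sum_4 skew_def vector_4_nth)

lemma alternating_dot_self:
  fixes M :: "'k::comm_ring_1^4^4"
  assumes "alternating M"
  shows "dot x (M *v x) = 0"
proof -
  obtain a b c d e f where "M = skew a b c d e f"
    using assms by (rule alternatingE)
  then show ?thesis
    by (simp add: skew_mult dot_def sum_4 vector_4_nth algebra_simps)
qed

lemma skew_diff: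
  "skew a b c d e f - skew a' b' c' d' e' f' = skew (a - a') (b - b') (c - c') (d - d') (e - e') (f - f')"
  by (simp add: skew_def vec_eq_iff forall_4 vector_4_nth)

lemma Pf_skew: "Pf (skew a b c d e f) = a * f - b * e + c * d"
  by (simp add: Pf_def skew_def vector_4_nth)

lemma skew_eq_iff: "skew a b c d e f = skew a' b' c' d' e' f' \<longleftrightarrow>
    a = a' \<and> b = b' \<and> c = c' \<and> d = d' \<and> e = e' \<and> f = f'"
  by (auto simp add: skew_def vec_eq_iff forall_4 vector_4_nth)

lemma pf_dual_skew: "pf_dual (skew a b c d e f) = skew f (- e) d c (- b) a"
  by (simp add: pf_dual_def skew_eq_iff) (simp add: skew_def vector_4_nth)

text \<open>For \<open>Pf M\<close> nonzero this inverts \<open>M\<close>; for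
  \<open>Pf M = 0\<close> it puts the columns of the dual into the kernel of
  \<open>M\<close>.\<close>

lemma alternating_mult_pf_dual:
  assumes "alternating M"
  shows "M *v (pf_dual M *v x) = - Pf M *s x" "pf_dual M *v (M *v x) = - Pf M *s x"
proof -
  obtain a b c d e f where M: "M = skew a b c d e f"
    using assms by (rule alternatingE)
  show "M *v (pf_dual M *v x) = - Pf M *s x" "pf_dual M *v (M *v x) = - Pf M *s x"
    unfolding M pf_dual_skew Pf_skew skew_mult
    by (simp_all add: vec_eq_iff forall_4 vector_4_nth algebra_simps)
qed

lemma alternating_kernel_trivial:
  fixes M :: "'k::field^4^4"
  assumes "alternating M" "Pf M \<noteq> 0" "M *v x = 0"
  shows "x = 0"
  using alternating_mult_pf_dual(2)[OF assms(1), of x] assms(2,3)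
  by (metis add.inverse_neutral matrix_vector_mult_0_right neg_equal_iff_equal vec.scale_eq_0_iff)

text \<open>A singular alternating matrix has even rank at most two, so its kernel meets every hyperplane.\<close>
lemma alternating_kernel_hyperplane:
  fixes M :: "'k::field^4^4"
  assumes M: "alternating M" and "Pf M = 0"
  obtains x where "x \<noteq> 0" "M *v x = 0" "dot d x = 0"
proof (cases "\<exists>i j. pf_dual M $ i $ j \<noteq> 0")
  case True
  then obtain i j where ij: "pf_dual M $ i $ j \<noteq> 0" by blast
  define col where "col k = pf_dual M *v axis k 1" for k
  have col: "col k $ l = pf_dual M $ l $ k" for k l
    by (simp add: col_def matrix_vector_mult_def axis_def if_distrib cong: if_cong)
  have alt: "alternating (pf_dual M)"
    by (simp add: pf_dual_def alternating_skew)
  have ker: "M *v col k = 0" for k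
    using alternating_mult_pf_dual(1)[OF M] assms(2) by (simp add: col_def)
  show ?thesis
  proof (cases "dot d (col j) = 0")
    case True
    moreover have "col j \<noteq> 0" using ij col by (metis zero_index)
    ultimately show ?thesis using that ker by blast
  next
    case False
    \<comment> \<open>A combination of two columns that is perpendicular to \<open>d\<close>. The
      dual has zero diagonal, so \<open>col j\<close> contributes nothing to the \<open>j\<close>-th
      entry, which is a nonzero product.\<close>
    let ?x = "dot d (col j) *s col i - dot d (col i) *s col j"
    have "pf_dual M $ j $ j = 0"
      using alt unfolding alternating_def by blast
    then have "?x $ j = dot d (col j) * pf_dual M $ j $ i"
      by (simp add: col)
    moreover have "pf_dual M $ j $ i \<noteq> 0"
      using alt ij unfolding alternating_def by (metis neg_0_equal_iff_equal)
    ultimately have "?x \<noteq> 0"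
      using False by (metis mult_eq_0_iff zero_index)
    moreover have "M *v ?x = 0"
      by (simp add: ker matrix_vector_mult_diff_distrib vec.scale)
    moreover have "dot d ?x = 0"
      by (simp add: dot_diff_right dot_scale_right)
    ultimately show ?thesis using that by blast
  qed
next
  case False
  obtain a b c e f g where "M = skew a b c e f g"
    using M by (rule alternatingE)
  \<comment> \<open>The dual only permutes entries up to sign, so it vanishes for
    \<open>M = 0\<close> alone. Then any nonzero vector perpendicular to \<open>d\<close> will
    do.\<close>
  with False have "M = 0"
    by (simp add: pf_dual_skew) (simp add: skew_def vec_eq_iff forall_4 vector_4_nth)
  define x :: "'k^4" where "x = (if d$1 = 0 then axis 1 1 else d$2 *s axis 1 1 - d$1 *s axis 2 1)"
  have "x \<noteq> 0"
  proof
    assume "x = 0"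
    then have "x$1 = 0" "x$2 = 0" by simp_all
    then show False by (simp add: x_def axis_def split: if_splits)
  qed
  moreover have "dot d x = 0"
    by (simp add: x_def dot_diff_right dot_scale_right dot_axis)
  ultimately show ?thesis using that \<open>M = 0\<close> by simp
qed

section \<open>Alternating matrices with pairwise nonsingular differences\<close>

context anisotropic_form
begin

text \<open>Entries are arranged so that \<open>Pf\<close> equals \<open>N x y\<close>. With
  \<open>vertical\<close>, the graphs of these matrices stand for the elliptic quadric of
  \<open>V\<close> and the zero matrix for \<open>p\<close>, which is why
  \<open>spread_matrices\<close> leaves out \<open>(0, 0)\<close>.\<close>

definition elliptic_matrix :: "'k \<Rightarrow> 'k \<Rightarrow> 'k^4^4" where
  "elliptic_matrix x y = skew x y 0 0 (- (c * y)) (x + y)"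

text \<open>The perp of the elliptic plane consists of all
  \<open>skew u v g d (u + c * v) (- u)\<close>, where \<open>Pf\<close> is
  \<open>g * d - N u v\<close>. Its singular points can be scaled to \<open>g = 1\<close> and
  \<open>d = N u v\<close>, except for one with \<open>g = 0\<close>, which is
  \<open>singular_matrix_inf\<close>.\<close>

definition singular_matrix :: "'k \<Rightarrow> 'k \<Rightarrow> 'k^4^4" where
  "singular_matrix u v = skew u v 1 (N u v) (u + c * v) (- u)"

definition singular_matrix_inf :: "'k^4^4" where
  "singular_matrix_inf = skew 0 0 0 1 0 0"

text \<open>In the six-dimensional space of alternating matrices with the quadratic form \<open>Pf\<close>, the elliptic
  matrices form an anisotropic plane.  Its perp is a four-dimensional space of minus type,
  and the singular matrices represent the points of the elliptic quadric in that perp.\<close>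
definition spread_matrices :: "('k^4^4) set" where
  "spread_matrices = case_prod elliptic_matrix ` (UNIV - {(0, 0)}) \<union>
     (range (case_prod singular_matrix) \<union> {singular_matrix_inf})"

text \<open>By perpendicularity a mixed difference retains only the elliptic part.\<close>

lemma Pf_differences:
  "Pf (elliptic_matrix x y - elliptic_matrix x' y') = N (x - x') (y - y')"
  "Pf (elliptic_matrix x y - singular_matrix u v) = N x y"
  "Pf (singular_matrix u v - elliptic_matrix x y) = N x y"
  "Pf (elliptic_matrix x y - singular_matrix_inf) = N x y"
  "Pf (singular_matrix_inf - elliptic_matrix x y) = N x y"
  "Pf (singular_matrix u v - singular_matrix u' v') = - N (u - u') (v - v')"
  "Pf (singular_matrix u v - singular_matrix_inf) = - 1"
  "Pf (singular_matrix_inf - singular_matrix u v) = - 1"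
  by (simp_all add: elliptic_matrix_def singular_matrix_def singular_matrix_inf_def skew_diff Pf_skew
      N_def power2_eq_square algebra_simps)

lemma alternating_spread_matrices: "M \<in> spread_matrices \<Longrightarrow> alternating M"
  by (auto simp: spread_matrices_def elliptic_matrix_def singular_matrix_def singular_matrix_inf_def
      alternating_skew)

lemma spread_matrices_Pf_diff:
  assumes "M \<in> spread_matrices" "M' \<in> spread_matrices" "M \<noteq> M'"
  shows "Pf (M - M') \<noteq> 0"
  using assms unfolding spread_matrices_def by (auto simp: Pf_differences N_eq_0_iff)

lemma card_spread_matrices: "card spread_matrices = 2 * CARD('k)\<^sup>2"
proof -
  let ?E = "case_prod elliptic_matrix ` (UNIV - {(0, 0)})" and ?S = "range (case_prod singular_matrix)"
  have "card ?E = card (UNIV - {(0 :: 'k, 0 :: 'k)})"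
    by (intro card_image inj_onI) (auto simp: elliptic_matrix_def skew_eq_iff)
  moreover have "card ?S = CARD('k \<times> 'k)"
    by (intro card_image injI) (auto simp: singular_matrix_def skew_eq_iff)
  moreover have "card (?S \<union> {singular_matrix_inf}) = card ?S + 1"
    by (subst card_Un_disjoint) (auto simp: singular_matrix_def singular_matrix_inf_def skew_eq_iff)
  moreover have "card spread_matrices = card ?E + card (?S \<union> {singular_matrix_inf})"
    unfolding spread_matrices_def
    by (rule card_Un_disjoint)
      (auto simp: elliptic_matrix_def singular_matrix_def singular_matrix_inf_def skew_eq_iff)
  ultimately show ?thesis
    by (simp add: card_Diff_singleton power2_eq_square)
qed

text \<open>Maximality on the level of matrices. Split \<open>P\<close> into an elliptic part with
  parameters \<open>x\<close>, \<open>y\<close> and a perp part. Representing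
  \<open>N u v - g * d\<close> by \<open>N\<close> yields a suitable elliptic matrix, unless this
  value, \<open>x\<close> and \<open>y\<close> all vanish; then \<open>P\<close> is a multiple of
  some \<open>singular_matrix r s\<close> or of \<open>singular_matrix_inf\<close>.\<close>

lemma spread_matrices_cover:
  assumes "alternating P"
  obtains M where "M \<in> spread_matrices" "Pf (P - M) = 0"
proof -
  obtain a b g d e f where P: "P = skew a b g d e f"
    using assms by (rule alternatingE)
  \<comment> \<open>\<open>x\<close> and \<open>y\<close> solve the linear system, of determinant
    \<open>4 * c - 1\<close>, that puts \<open>P - elliptic_matrix x y\<close> into the
    perp.\<close>
  define y where "y = (a + 2 * c * b - 2 * e - f) / (4 * c - 1)"
  define x where "x = a + c * b - e - 2 * c * y"
  define u where "u = a - x"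
  define v where "v = b - y"
  have y: "(4 * c - 1) * y = a + 2 * c * b - 2 * e - f"
    using disc_nonzero by (simp add: y_def)
  have a: "a = x + u" and b: "b = y + v" by (simp_all add: u_def v_def)
  have e: "e = - (c * y) + u + c * v"
    by (simp add: u_def v_def x_def algebra_simps)
  have f: "f = x + y - u"
    using y by (simp add: u_def x_def algebra_simps)
  have el: "Pf (P - elliptic_matrix x' y') = N (x - x') (y - y') - (N u v - g * d)" for x' y'
    by (simp add: P a b e f elliptic_matrix_def skew_diff Pf_skew N_def power2_eq_square algebra_simps)
  show ?thesis
  proof (cases "N u v - g * d \<noteq> 0 \<or> x \<noteq> 0 \<or> y \<noteq> 0")
    case True
    then obtain x' y' where xy: "N x' y' = N u v - g * d" "x' \<noteq> x \<or> y' \<noteq> y"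
      by (rule N_surj_avoiding)
    \<comment> \<open>The representation avoiding \<open>(x, y)\<close> is what keeps this matrix
      nonzero.\<close>
    have "elliptic_matrix (x - x') (y - y') \<in> spread_matrices"
      using xy(2) by (auto simp: spread_matrices_def intro!: image_eqI[of _ _ "(x - x', y - y')"])
    then show ?thesis
      using that el xy(1) by simp
  next
    case False
    then have 0: "x = 0" "y = 0" "N u v = g * d" by auto
    show ?thesis
    proof (cases "g = 0")
      case True
      then have "Pf (P - singular_matrix_inf) = 0"
        using 0 by (simp add: P a b e f N_eq_0_iff singular_matrix_inf_def skew_diff Pf_skew)
      then show ?thesis
        using that by (auto simp: spread_matrices_def)
    next
      case False
      define r s where "r = u / g" and "s = v / g"
      have u: "u = g * r" and v: "v = g * s" using False by (simp_all add: r_def s_def)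
      have "g * (g * N r s - d) = 0"
        using 0(3) by (simp add: u v N_def power2_eq_square algebra_simps)
      then have d: "d = g * N r s" using False by simp
      have "Pf (P - singular_matrix r s) = 0"
        by (simp add: P a b e f 0 d u v singular_matrix_def skew_diff Pf_skew N_def
            power2_eq_square algebra_simps)
      then show ?thesis
        using that by (auto simp: spread_matrices_def)
    qed
  qed
qed

end

section \<open>Quadratic spaces\<close>

lemma polar_commute: "polar Q u v = polar Q v u"
  by (simp add: polar_def add.commute)

lemma Q_add: "Q (u + v) = Q u + Q v + polar Q u v"
  by (simp add: polar_def)

context quadratic_space
begin

lemma polar_add_right: "polar Q u (v + w) = polar Q u v + polar Q u w"
  using polar_linear module_hom.add unfolding Vector_Spaces.linear_def by blast

lemma polar_scale_right: "polar Q u (scale c v) = c * polar Q u v"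
  using polar_linear module_hom.scale unfolding Vector_Spaces.linear_def by blast

lemma polar_0_right: "polar Q u 0 = 0"
  using polar_scale_right[of u 0 0] by simp

lemma polar_sum_right: "polar Q u (sum g A) = (\<Sum>i\<in>A. polar Q u (g i))"
  by (induction A rule: infinite_finite_induct) (simp_all add: polar_add_right polar_0_right)

lemma polar_diff_right: "polar Q u (v - w) = polar Q u v - polar Q u w"
  using polar_add_right[of u "v - w" w] by simp

lemma polar_scale_left: "polar Q (scale c u) v = c * polar Q u v"
  by (simp add: polar_commute[of Q _ v] polar_scale_right)

lemma polar_diff_left: "polar Q (u - w) v = polar Q u v - polar Q w v"
  by (simp add: polar_commute[of Q _ v] polar_diff_right)

lemma polar_sum_left: "polar Q (sum g A) u = (\<Sum>i\<in>A. polar Q (g i) u)"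
  by (simp add: polar_commute[of Q _ u] polar_sum_right)

lemma Q_0: "Q 0 = 0"
  using Q_scale[of 0 0] by simp

lemma polar_self: "polar Q u u = 2 * Q u"
proof -
  have "u + u = scale 2 u"
    by (metis one_add_one scale_left_distrib scale_one)
  then show ?thesis by (simp add: polar_def Q_scale power2_eq_square)
qed

lemma Q_sum_eq_0:
  assumes "\<And>i. i \<in> A \<Longrightarrow> Q (g i) = 0" "\<And>i j. i \<in> A \<Longrightarrow> j \<in> A \<Longrightarrow> polar Q (g i) (g j) = 0"
  shows "Q (sum g A) = 0"
  using assms
  by (induction A rule: infinite_finite_induct) (simp_all add: Q_0 Q_add[of Q] polar_sum_right)

lemma totally_singular_polar:
  assumes "totally_singular U" "u \<in> U" "v \<in> U"
  shows "polar Q u v = 0"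
  using assms subspace_add unfolding totally_singular_def polar_def by (metis diff_self)

text \<open>Gram-Schmidt, one pair at a time: a new vector of \<open>U\<close> is made perpendicular
  to the old \<open>f i\<close>, nondegeneracy supplies a partner, and the partner is made
  perpendicular to the old pairs and then singular.\<close>

lemma ex_hyperbolic_pairs:
  assumes "nondegenerate" "totally_singular U" "k \<le> dim U"
  shows "\<exists>e f :: nat \<Rightarrow> 'v. \<forall>i<k. e i \<in> U \<and> Q (f i) = 0 \<and>
    (\<forall>j<k. polar Q (f i) (f j) = 0 \<and> polar Q (e i) (f j) = (if i = j then 1 else 0))"
  using assms(3)
proof (induction k)
  case (Suc k)
  then have "k \<le> dim U" by simp
  from Suc.IH[OF this] obtain e f :: "nat \<Rightarrow> 'v" where
    IH: "\<forall>i<k. e i \<in> U \<and> Q (f i) = 0 \<and>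
      (\<forall>j<k. polar Q (f i) (f j) = 0 \<and> polar Q (e i) (f j) = (if i = j then 1 else 0))"
    by blast
  then have e: "\<And>i. i < k \<Longrightarrow> e i \<in> U" and f: "\<And>i. i < k \<Longrightarrow> Q (f i) = 0"
    and ff: "\<And>i j. i < k \<Longrightarrow> j < k \<Longrightarrow> polar Q (f i) (f j) = 0"
    and ef: "\<And>i j. i < k \<Longrightarrow> j < k \<Longrightarrow> polar Q (e i) (f j) = (if i = j then 1 else 0)"
    by blast+
  have U: "subspace U" and QU: "\<And>u. u \<in> U \<Longrightarrow> Q u = 0"
    using assms(2) by (auto simp: totally_singular_def)
  have UU: "polar Q u v = 0" if "u \<in> U" "v \<in> U" for u v
    using that by (rule totally_singular_polar[OF assms(2)])
  have delta: "(\<Sum>i<k. c i * polar Q (e i) (f j)) = c j" "(\<Sum>i<k. c i * polar Q (e j) (f i)) = c j"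
    if "j < k" for c j
  proof -
    have "(\<Sum>i<k. c i * polar Q (e i) (f j)) = (\<Sum>i<k. if i = j then c i else 0)"
      using that by (intro sum.cong) (simp_all add: ef)
    moreover have "(\<Sum>i<k. c i * polar Q (e j) (f i)) = (\<Sum>i<k. if i = j then c i else 0)"
      using that by (intro sum.cong) (auto simp add: ef)
    ultimately show "(\<Sum>i<k. c i * polar Q (e i) (f j)) = c j"
      "(\<Sum>i<k. c i * polar Q (e j) (f i)) = c j"
      using that by simp_all
  qed
  have "\<not> U \<subseteq> span (e ` {..<k})"
  proof
    assume "U \<subseteq> span (e ` {..<k})"
    then have "dim U \<le> card (e ` {..<k})"
      by (rule dim_le_card) simp
    also have "\<dots> \<le> k"
      using card_image_le[of "{..<k}" e] by simp
    finally show False using Suc.prems by simp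
  qed
  then obtain u where u: "u \<in> U" "u \<notin> span (e ` {..<k})" by blast
  define a where "a = u - (\<Sum>i<k. scale (polar Q u (f i)) (e i))"
  have aU: "a \<in> U"
    unfolding a_def using u(1) e by (intro subspace_diff[OF U] subspace_sum[OF U] subspace_scale[OF U]) auto
  have "(\<Sum>i<k. scale (polar Q u (f i)) (e i)) \<in> span (e ` {..<k})"
    by (intro span_sum span_scale span_base) auto
  then have "a \<noteq> 0" using u(2) by (auto simp: a_def)
  have af: "polar Q a (f j) = 0" if "j < k" for j
    using delta(1)[OF that] by (simp add: a_def polar_diff_left polar_sum_left polar_scale_left)
  obtain w where w: "polar Q a w \<noteq> 0"
    using assms(1) \<open>a \<noteq> 0\<close> QU[OF aU] unfolding nondegenerate_def by blast
  define w1 where "w1 = scale (inverse (polar Q a w)) w"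
  have w1: "polar Q a w1 = 1"
    using w by (simp add: w1_def polar_scale_right)
  define w2 where "w2 = w1 - (\<Sum>i<k. scale (polar Q w1 (f i)) (e i)) - (\<Sum>i<k. scale (polar Q w1 (e i)) (f i))"
  have aw2: "polar Q a w2 = 1"
    using w1 UU[OF aU e] af by (simp add: w2_def polar_diff_right polar_sum_right polar_scale_right)
  have ew2: "polar Q (e j) w2 = 0" if "j < k" for j
    using delta(2)[OF that] UU e that
    by (simp add: w2_def polar_diff_right polar_sum_right polar_scale_right polar_commute[of Q "e j" w1])
  have fw2: "polar Q (f j) w2 = 0" if "j < k" for j
    using delta(1)[OF that] ff that
    by (simp add: w2_def polar_diff_right polar_sum_right polar_scale_right
        polar_commute[of Q "f j" w1] polar_commute[of Q "f j" "e _"])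
  \<comment> \<open>Since \<open>a\<close> is singular and \<open>polar Q a w2 = 1\<close>, removing
    \<open>Q w2\<close> times \<open>a\<close> cancels \<open>Q w2\<close> without a division by
    2.\<close>
  define b where "b = w2 - scale (Q w2) a"
  have ab: "polar Q a b = 1"
    using aw2 UU[OF aU aU] by (simp add: b_def polar_diff_right polar_scale_right)
  have eb: "polar Q (e j) b = 0" if "j < k" for j
    using that ew2 UU[OF e aU] by (simp add: b_def polar_diff_right polar_scale_right)
  have fb: "polar Q (f j) b = 0" if "j < k" for j
    using fw2[OF that] af[OF that] polar_commute[of Q "f j" a]
    by (simp add: b_def polar_diff_right polar_scale_right)
  have Qb: "Q b = 0"
  proof -
    have "Q w2 = Q (b + scale (Q w2) a)" by (simp add: b_def)
    also have "\<dots> = Q b + Q w2"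
      using QU[OF aU] ab by (simp add: Q_add[of Q] Q_scale polar_scale_right polar_commute[of Q b])
    finally show ?thesis by simp
  qed
  have bb: "polar Q b b = 0"
    using Qb by (simp add: polar_self)
  define e' f' where "e' = e(k := a)" and "f' = f(k := b)"
  have "e' i \<in> U \<and> Q (f' i) = 0 \<and> polar Q (f' i) (f' j) = 0 \<and>
      polar Q (e' i) (f' j) = (if i = j then 1 else 0)"
    if "i < Suc k" "j < Suc k" for i j
    using that e f ff ef aU af ab eb fb Qb bb polar_commute[of Q b "f j"]
    unfolding e'_def f'_def by (cases "i = k"; cases "j = k") (simp_all add: less_Suc_eq)
  then have "\<forall>i<Suc k. e' i \<in> U \<and> Q (f' i) = 0 \<and>
      (\<forall>j<Suc k. polar Q (f' i) (f' j) = 0 \<and> polar Q (e' i) (f' j) = (if i = j then 1 else 0))"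
    by blast
  then show ?case by (rule exI[of _ e', OF exI[of _ f']])
qed simp

text \<open>The \<open>Max\<close> in \<open>witt_index\<close> is attained: positive dimension
  excludes the infinite-dimensional case, where \<open>dim\<close> is 0, so the dimensions are
  bounded.\<close>

lemma ex_maximal_totally_singular:
  assumes "0 < dim UNIV"
  obtains U where "totally_singular U" "dim U = witt_index"
proof -
  obtain B where B: "B \<subseteq> UNIV" "independent B" "UNIV \<subseteq> span B" "card B = dim UNIV"
    by (rule basis_exists)
  have "finite B"
    using assms unfolding B(4)[symmetric] by (rule card_ge_0_finite)
  let ?D = "{dim U | U. totally_singular U}"
  have "dim U \<le> card B" for U
    by (rule dim_le_card[OF subset_trans[OF subset_UNIV B(3)] \<open>finite B\<close>])
  then have "?D \<subseteq> {..card B}" by (intro subsetI, elim CollectE exE conjE) simp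
  then have "finite ?D"
    by (rule finite_subset) simp
  moreover have "totally_singular {0}"
    by (simp add: totally_singular_def Q_0)
  then have "dim {0} \<in> ?D" by (intro CollectI exI[of _ "{0}"] conjI refl)
  then have "?D \<noteq> {}" by (rule ex_in_conv[THEN iffD1, OF exI])
  ultimately have "witt_index \<in> ?D"
    unfolding witt_index_def by (rule Max_in)
  then obtain U where "witt_index = dim U" "totally_singular U"
    by (rule CollectE) (elim exE conjE)
  then show ?thesis by (intro that[of U]) simp_all
qed

end

section \<open>Hyperbolic frames in dimension eight\<close>

locale hyperbolic_frame = quadratic_space scale Q
  for scale :: "'k::field \<Rightarrow> 'v::ab_group_add \<Rightarrow> 'v" and Q +
  fixes e f :: "4 \<Rightarrow> 'v"
  assumes dim_8: "dim UNIV = 8"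
    and Q_e: "Q (e i) = 0" and Q_f: "Q (f i) = 0"
    and polar_ee: "polar Q (e i) (e j) = 0" and polar_ff: "polar Q (f i) (f j) = 0"
    and polar_ef: "polar Q (e i) (f j) = (if i = j then 1 else 0)"
begin

definition pt :: "'k^4 \<Rightarrow> 'k^4 \<Rightarrow> 'v" where
  "pt x y = (\<Sum>i\<in>UNIV. scale (x$i) (e i)) + (\<Sum>i\<in>UNIV. scale (y$i) (f i))"

lemma pt_add: "pt (x + x') (y + y') = pt x y + pt x' y'"
  by (simp add: pt_def scale_left_distrib sum.distrib)

lemma pt_scale: "pt (c *s x) (c *s y) = scale c (pt x y)"
  by (simp add: pt_def scale_right_distrib scale_sum_right)

lemma pt_0: "pt 0 0 = 0"
  by (simp add: pt_def)

lemma polar_e_pt: "polar Q (e i) (pt x y) = y$i"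
  by (simp add: pt_def polar_add_right polar_sum_right polar_scale_right polar_ee polar_ef
      if_distrib cong: if_cong)

lemma polar_f_pt: "polar Q (f i) (pt x y) = x$i"
  by (simp add: pt_def polar_add_right polar_sum_right polar_scale_right polar_ff polar_ef
      polar_commute[of Q "f i" "e _"] if_distrib cong: if_cong)

lemma pt_eq_iff: "pt x y = pt x' y' \<longleftrightarrow> x = x' \<and> y = y'"
  by (metis polar_e_pt polar_f_pt vec_eq_iff)

lemma pt_eq_0_iff: "pt x y = 0 \<longleftrightarrow> x = 0 \<and> y = 0"
  using pt_eq_iff[of x y 0 0] by (simp add: pt_0)

lemma Q_pt: "Q (pt x y) = dot x y"
proof -
  have "Q (\<Sum>i\<in>UNIV. scale (x$i) (e i)) = 0" "Q (\<Sum>i\<in>UNIV. scale (y$i) (f i)) = 0"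
    by (rule Q_sum_eq_0; simp add: Q_scale Q_e Q_f polar_scale_left polar_scale_right polar_ee polar_ff)+
  then show ?thesis
    by (simp add: pt_def Q_add[of Q] polar_sum_left polar_sum_right polar_scale_left polar_scale_right
        polar_ef dot_def mult.commute if_distrib cong: if_cong)
qed

lemma polar_pt: "polar Q (pt x y) (pt x' y') = dot x y' + dot x' y"
  by (simp add: polar_def pt_add[symmetric] Q_pt dot_add_left dot_add_right)

lemma finite_dimensional: obtains B where "finite_dimensional_vector_space scale B"
proof -
  obtain B where B: "B \<subseteq> UNIV" "independent B" "UNIV \<subseteq> span B" "card B = dim UNIV"
    by (rule basis_exists)
  have "finite B"
    by (rule card_ge_0_finite) (use B(4) dim_8 in linarith)
  then have "finite_dimensional_vector_space scale B"
    using B by unfold_locales auto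
  then show ?thesis using that by blast
qed

lemma subspace_dim_range:
  fixes g :: "'k^4 \<Rightarrow> 'v"
  assumes "\<And>x y. g (x + y) = g x + g y" "\<And>c x. g (c *s x) = scale c (g x)" "inj g"
  shows "subspace (range g)" "dim (range g) = 4"
proof -
  interpret P: finite_dimensional_vector_space_pair_1 "(*s) :: 'k \<Rightarrow> 'k^4 \<Rightarrow> 'k^4" cart_basis scale ..
  have g: "Vector_Spaces.linear (*s) scale g"
    unfolding Vector_Spaces.linear_iff
    using assms vec.vector_space_axioms vector_space_axioms by auto
  interpret g: Vector_Spaces.linear "(*s)" scale g by (rule g)
  show "subspace (range g)"
    by (rule g.subspace_image) simp
  show "dim (range g) = 4"
    using P.dim_image_eq[OF g, of UNIV] assms(3) by (simp add: card_cart_basis)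
qed

text \<open>\<open>Q\<close> takes the values \<open>dot x (M *v x)\<close> here, so the space is
  totally singular exactly for alternating \<open>M\<close>.\<close>

definition graph :: "'k^4^4 \<Rightarrow> 'v set" where
  "graph M = range (\<lambda>x. pt x (M *v x))"

definition vertical :: "'v set" where
  "vertical = range (pt 0)"

lemma graph_subspace: "subspace (graph M)" "dim (graph M) = 4"
  unfolding graph_def
  by (rule subspace_dim_range;
      simp add: pt_add pt_scale matrix_vector_right_distrib vec.scale inj_def pt_eq_iff)+

lemma vertical_subspace: "subspace vertical" "dim vertical = 4"
  unfolding vertical_def
  by (rule subspace_dim_range;
      (simp add: pt_add[of 0 0, simplified] pt_scale[of _ 0, simplified] inj_def pt_eq_iff))+

lemma graph_Int_vertical: "graph M \<inter> vertical = {0}"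
  by (auto simp: graph_def vertical_def pt_eq_iff pt_0 intro: rev_image_eqI[of 0])

text \<open>\<open>graph 0\<close> and \<open>vertical\<close> have dimension 4 and meet trivially,
  so they span the space of dimension 8.\<close>

lemma pt_surj: obtains x y where "v = pt x y"
proof -
  obtain B where "finite_dimensional_vector_space scale B"
    by (rule finite_dimensional)
  then interpret F: finite_dimensional_vector_space scale B .
  let ?H = "graph 0"
  have H: "subspace ?H" "dim ?H = 4" by (rule graph_subspace)+
  have "?H \<inter> vertical = {0}" by (rule graph_Int_vertical)
  then have "dim {x + y | x y. x \<in> ?H \<and> y \<in> vertical} = dim UNIV"
    using F.dim_sums_Int[OF H(1) vertical_subspace(1)] H vertical_subspace dim_8 by simp
  then have "{x + y | x y. x \<in> ?H \<and> y \<in> vertical} = UNIV"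
    by (intro F.subspace_dim_equal subspace_sums H vertical_subspace) auto
  then have "\<exists>a b. v = a + b \<and> a \<in> ?H \<and> b \<in> vertical"
    using UNIV_I[of v] by (simp only: set_eq_iff mem_Collect_eq UNIV_I simp_thms)
  then obtain a b where v: "v = a + b" and ab: "a \<in> ?H" "b \<in> vertical"
    by (elim exE conjE)
  obtain x where a: "a = pt x 0"
    using ab(1) unfolding graph_def by (elim imageE) simp
  obtain y where b: "b = pt 0 y"
    using ab(2) unfolding vertical_def by (elim imageE)
  have "v = pt x y"
    using pt_add[of x 0 0 y] by (simp add: v a b)
  then show ?thesis by (rule that)
qed

lemma graph_Int_graph:
  assumes "alternating (M - M')" "Pf (M - M') \<noteq> 0"
  shows "graph M \<inter> graph M' = {0}"
proof (intro equalityI subsetI)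
  fix v assume "v \<in> graph M \<inter> graph M'"
  then obtain x where x: "v = pt x (M *v x)" "M *v x = M' *v x"
    by (auto simp: graph_def pt_eq_iff)
  have "(M - M') *v x = 0"
    using x(2) by (simp add: matrix_vector_mult_diff_rdistrib)
  then have "x = 0"
    by (rule alternating_kernel_trivial[OF assms])
  then show "v \<in> {0}" by (simp add: x(1) pt_0)
next
  fix v :: 'v assume "v \<in> {0}"
  then show "v \<in> graph M \<inter> graph M'"
    using subspace_0[OF graph_subspace(1)] by auto
qed

text \<open>The projection \<open>p\<close> along \<open>vertical\<close> is injective on
  \<open>U\<close>, hence onto by dimension. Preimages of the unit vectors supply the columns of
  \<open>M\<close>.\<close>

lemma complement_of_vertical_contains_graph:
  assumes U: "subspace U" "dim U = 4" and disj: "U \<inter> vertical = {0}"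
  obtains M where "graph M \<subseteq> U"
proof -
  obtain B where "finite_dimensional_vector_space scale B"
    by (rule finite_dimensional)
  then interpret F: finite_dimensional_vector_space scale B .
  interpret P: finite_dimensional_vector_space_pair_1 scale B "(*s) :: 'k \<Rightarrow> 'k^4 \<Rightarrow> 'k^4" ..
  define p :: "'v \<Rightarrow> 'k^4" where "p v = (\<chi> i. polar Q (f i) v)" for v
  have p_pt: "p (pt x y) = x" for x y
    by (simp add: p_def polar_f_pt vec_eq_iff)
  have p: "Vector_Spaces.linear scale (*s) p"
    unfolding Vector_Spaces.linear_iff using vec.vector_space_axioms vector_space_axioms
    by (simp add: p_def polar_add_right polar_scale_right vec_eq_iff)
  interpret p: Vector_Spaces.linear scale "(*s)" p by (rule p)
  have "inj_on p U"
  proof (rule inj_onI)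
    fix u v assume uv: "u \<in> U" "v \<in> U" "p u = p v"
    obtain x y where xy: "u - v = pt x y" by (rule pt_surj)
    have "x = p (u - v)" by (simp add: xy p_pt)
    also have "\<dots> = 0" using uv(3) by (simp add: p.diff)
    finally have "u - v \<in> vertical"
      using xy by (simp add: vertical_def)
    moreover have "u - v \<in> U"
      using uv by (intro subspace_diff[OF U(1)])
    ultimately have "u - v = 0" using disj by blast
    then show "u = v" by simp
  qed
  then have "inj_on p (span U)"
    using U(1) by (simp only: span_eq_iff[THEN iffD2])
  then have "vec.dim (p ` U) = 4"
    using P.dim_image_eq[OF p, of U] U(2) by (simp only:)
  then have "vec.dim (p ` U) = vec.dim (UNIV :: ('k^4) set)"
    by (simp add: card_cart_basis)
  then have "p ` U = UNIV"
    by (intro vec.subspace_dim_equal p.subspace_image U) simp_all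
  have "\<exists>y. pt (axis j 1) y \<in> U" for j
  proof -
    have "axis j 1 \<in> p ` U" by (simp only: \<open>p ` U = UNIV\<close> UNIV_I)
    then obtain u where u: "u \<in> U" "p u = axis j 1" by (elim imageE) simp
    obtain x y where "u = pt x y" by (rule pt_surj)
    then show ?thesis using u p_pt[of x y] by auto
  qed
  then obtain y where y: "\<And>j. pt (axis j 1) (y j) \<in> U" by metis
  define M where "M = (\<chi> i j. y j $ i)"
  have pt_sum: "pt (\<Sum>j\<in>A. g j) (\<Sum>j\<in>A. h j) = (\<Sum>j\<in>A. pt (g j) (h j))"
    for A and g h :: "4 \<Rightarrow> 'k^4"
    by (induction A rule: infinite_finite_induct) (simp_all add: pt_0 pt_add)
  have "pt x (M *v x) \<in> U" for x
  proof -
    have "x = (\<Sum>j\<in>UNIV. x$j *s axis j 1)"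
      by (simp add: vec_eq_iff axis_def if_distrib cong: if_cong)
    moreover have "M *v x = (\<Sum>j\<in>UNIV. x$j *s y j)"
      by (simp add: M_def vec_eq_iff matrix_vector_mult_def mult.commute)
    ultimately have "pt x (M *v x) = (\<Sum>j\<in>UNIV. scale (x$j) (pt (axis j 1) (y j)))"
      using pt_sum[of "\<lambda>j. x$j *s axis j 1" UNIV "\<lambda>j. x$j *s y j"] by (simp add: pt_scale)
    then show ?thesis
      using y by (auto intro!: subspace_sum[OF U(1)] subspace_scale[OF U(1)])
  qed
  then show ?thesis using that by (auto simp: graph_def)
qed

end

section \<open>The spread\<close>

locale spread_frame = hyperbolic_frame scale Q e f + anisotropic_form c
  for scale :: "'k::{field,finite} \<Rightarrow> 'v::ab_group_add \<Rightarrow> 'v" and Q e f and c :: 'k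
begin

definition spread :: "'v set set" where
  "spread = insert vertical (graph ` spread_matrices)"

lemma spread_subspace: "U \<in> spread \<Longrightarrow> subspace U" "U \<in> spread \<Longrightarrow> dim U = 4"
  by (auto simp: spread_def graph_subspace vertical_subspace)

lemma spread_Q:
  assumes "U \<in> spread" "u \<in> U"
  shows "Q u = 0"
proof -
  have "dot x (M *v x) = 0" if "M \<in> spread_matrices" for M x
    using alternating_spread_matrices[OF that] by (rule alternating_dot_self)
  then show ?thesis
    using assms by (auto simp: spread_def graph_def vertical_def Q_pt dot_zero)
qed

lemma spread_totally_singular: "U \<in> spread \<Longrightarrow> totally_singular U"
  by (simp add: totally_singular_def spread_subspace spread_Q)

lemma spread_graphs_disjoint:
  assumes "M \<in> spread_matrices" "M' \<in> spread_matrices" "M \<noteq> M'"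
  shows "graph M \<inter> graph M' = {0}"
  using assms
  by (intro graph_Int_graph spread_matrices_Pf_diff alternating_diff alternating_spread_matrices)

lemma spread_pairwise: "pairwise (\<lambda>U W. U \<inter> W = {0}) spread"
  unfolding pairwise_def spread_def
  using spread_graphs_disjoint graph_Int_vertical by (auto simp: Int_commute[of vertical])

lemma card_spread: "card spread = 2 * CARD('k)\<^sup>2 + 1"
proof -
  \<comment> \<open>Trivial intersection separates only nonzero spaces, since \<open>{0}\<close>
    meets itself in \<open>{0}\<close>.\<close>
  have nontrivial: "graph M \<noteq> {0}" for M
  proof -
    have "pt (axis 1 1) (M *v axis 1 1) \<in> graph M"
      by (simp add: graph_def)
    moreover have "pt (axis 1 1) (M *v axis 1 1) \<noteq> 0"
      by (simp add: pt_eq_0_iff axis_eq_0_iff)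
    ultimately show ?thesis by blast
  qed
  have "inj_on graph spread_matrices"
    using spread_graphs_disjoint nontrivial by (intro inj_onI) (metis Int_absorb)
  then have "card (graph ` spread_matrices) = 2 * CARD('k)\<^sup>2"
    by (simp add: card_image card_spread_matrices)
  moreover have "vertical \<notin> graph ` spread_matrices"
    using graph_Int_vertical nontrivial by (metis Int_absorb imageE)
  ultimately show ?thesis
    unfolding spread_def by (subst card_insert_disjoint) auto
qed

text \<open>In characteristic two the diagonal of a symmetric matrix \<open>M\<close> consists of squares \<open>(d$i)\<^sup>2\<close>, and
  subtracting the rank one matrix of \<open>d\<close> makes \<open>M\<close> alternating without changing it
  on the hyperplane perpendicular to \<open>d\<close>.\<close>
lemma spread_meets:
  assumes U: "subspace U" "dim U = 4" and iso: "\<And>u v. u \<in> U \<Longrightarrow> v \<in> U \<Longrightarrow> polar Q u v = 0"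
    and sing: "(2::'k) = 0 \<or> (\<forall>u\<in>U. Q u = 0)"
  obtains W where "W \<in> spread" "U \<inter> W \<noteq> {0}"
proof (cases "U \<inter> vertical = {0}")
  case True
  then obtain M where "graph M \<subseteq> U"
    using complement_of_vertical_contains_graph[OF U] by blast
  then have M: "pt x (M *v x) \<in> U" for x
    by (auto simp: graph_def)
  have ax: "dot (axis i 1) (M *v axis j 1) = M$i$j" for i j
    by (simp add: dot_commute[of "axis i 1"] dot_axis matrix_vector_mult_def)
      (simp add: axis_def if_distrib cong: if_cong)
  have sym: "M$i$j + M$j$i = 0" for i j
    using iso[OF M M, of "axis i 1" "axis j 1"] by (simp add: polar_pt ax)
  \<comment> \<open>Outside characteristic two, \<open>U\<close> is totally singular, the diagonal
    of \<open>M\<close> vanishes, and \<open>d = 0\<close> serves. The second condition keeps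
    \<open>P\<close> skew in both cases.\<close>
  obtain d :: "'k^4" where d: "\<And>i. (d$i)\<^sup>2 = M$i$i" and 2: "\<And>i j. 2 * (d$i * d$j) = 0"
  proof (cases "(2::'k) = 0")
    case True
    have "\<exists>r. r\<^sup>2 = M$i$i" for i
      using finite_field_square_char_2[OF True] by metis
    then obtain r where "\<And>i. (r i)\<^sup>2 = M$i$i" by metis
    then show ?thesis
      using that[of "\<chi> i. r i"] True by simp
  next
    case False
    then have "M$i$i = 0" for i
      using sing M[of "axis i 1"] Q_pt[of "axis i 1" "M *v axis i 1"] by (simp add: ax)
    then show ?thesis
      using that[of 0] by simp
  qed
  define P where "P = (\<chi> i j. M$i$j - d$i * d$j)"
  have "P$i$j = - P$j$i" for i j
  proof -
    have "P$i$j + P$j$i = (M$i$j + M$j$i) - 2 * (d$i * d$j)"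
      by (simp add: P_def algebra_simps)
    then show ?thesis
      unfolding sym 2 by (simp add: eq_neg_iff_add_eq_0)
  qed
  moreover have "P$i$i = 0" for i
    by (simp add: P_def d[symmetric] power2_eq_square)
  ultimately have P: "alternating P"
    unfolding alternating_def by blast
  then obtain S where S: "S \<in> spread_matrices" "Pf (P - S) = 0"
    by (rule spread_matrices_cover)
  obtain x where x: "x \<noteq> 0" "(P - S) *v x = 0" "dot d x = 0"
    using alternating_kernel_hyperplane[OF alternating_diff[OF P alternating_spread_matrices[OF S(1)]] S(2)] .
  \<comment> \<open>\<open>M\<close> and \<open>P\<close> agree where \<open>dot d x = 0\<close>, so
    \<open>x\<close> yields a common point of \<open>U\<close> and \<open>graph S\<close>.\<close>
  have "M *v x = P *v x + dot d x *s d"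
    by (simp add: P_def vec_eq_iff matrix_vector_mult_def dot_def sum_distrib_left
        sum_subtractf algebra_simps)
  then have "M *v x = S *v x"
    using x by (simp add: matrix_vector_mult_diff_rdistrib)
  then have "pt x (M *v x) \<in> graph S"
    by (simp add: graph_def)
  then have "pt x (M *v x) \<in> U \<inter> graph S"
    using M[of x] by blast
  moreover have "pt x (M *v x) \<noteq> 0"
    using x(1) by (simp add: pt_eq_0_iff)
  ultimately show ?thesis
    using that[of "graph S"] S(1) by (auto simp: spread_def)
next
  case False
  then show ?thesis
    using that[of vertical] by (simp add: spread_def)
qed

end

lemma (in O_plus_8_space) ex_hyperbolic_frame: "\<exists>e f. hyperbolic_frame scale Q e f"
proof -
  have "0 < dim UNIV" by (simp only: dim_8)
  then obtain U where U: "totally_singular U" "dim U = 4"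
    using ex_maximal_totally_singular plus_type by metis
  obtain e f :: "nat \<Rightarrow> 'v" where ef: "\<forall>i<4. e i \<in> U \<and> Q (f i) = 0 \<and>
      (\<forall>j<4. polar Q (f i) (f j) = 0 \<and> polar Q (e i) (f j) = (if i = j then 1 else 0))"
    using ex_hyperbolic_pairs[OF nondegenerate U(1), of 4] U(2) by auto
  \<comment> \<open>The pairs come numbered 0 to 3; \<open>h\<close> carries them over to the index
    type \<open>4\<close>.\<close>
  obtain h :: "4 \<Rightarrow> nat" where h: "bij_betw h UNIV {0..<4}"
    using ex_bij_betw_finite_nat[of "UNIV :: 4 set"] by auto
  then have h4: "h i < 4" and h_eq: "h i = h j \<longleftrightarrow> i = j" for i j
    by (auto simp: bij_betw_def inj_def)
  have "hyperbolic_frame scale Q (e \<circ> h) (f \<circ> h)"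
  proof
    show "dim UNIV = 8" by (rule dim_8)
    show "Q ((e \<circ> h) i) = 0" for i
      using ef h4 U(1) by (simp add: totally_singular_def)
    show "Q ((f \<circ> h) i) = 0" for i
      using ef h4 by simp
    show "polar Q ((e \<circ> h) i) ((e \<circ> h) j) = 0" for i j
      using ef h4 by (simp add: totally_singular_polar[OF U(1)])
    show "polar Q ((f \<circ> h) i) ((f \<circ> h) j) = 0" for i j
      using ef h4 by simp
    show "polar Q ((e \<circ> h) i) ((f \<circ> h) j) = (if i = j then 1 else 0)" for i j
      using ef h4 h_eq by simp
  qed
  then show ?thesis by blast
qed

section \<open>Maximality among orthogonal and symplectic partial spreads\<close>

theorem theorem7p10:
  fixes scale :: "'k::{field,finite} \<Rightarrow> 'v::ab_group_add \<Rightarrow> 'v"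
    and Q :: "'v \<Rightarrow> 'k" and q :: nat
  assumes "primepow q" and "CARD('k) = q" and "O_plus_8_space scale Q"
  shows "\<exists>\<Sigma>. O_plus_8_space.maximal_orthogonal_partial_spread scale Q \<Sigma> \<and>
           card \<Sigma> = 2 * q\<^sup>2 + 1 \<and>
           (even q \<longrightarrow> O_plus_8_space.maximal_symplectic_partial_spread scale Q \<Sigma>)"
proof -
  interpret O_plus_8_space scale Q by fact
  obtain c :: 'k where c: "\<forall>t. t\<^sup>2 + t + c \<noteq> 0"
    using finite_field_ex_irreducible_quadratic by blast
  obtain e f where "hyperbolic_frame scale Q e f"
    using ex_hyperbolic_frame by (elim exE)
  then interpret hyperbolic_frame scale Q e f .
  interpret spread_frame scale Q e f c
    by unfold_locales (use c in blast)
  \<comment> \<open>A proper extension has a member outside \<open>spread\<close>, meeting every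
    member of \<open>spread\<close> trivially; \<open>spread_meets\<close> will forbid this.\<close>
  have proper: "\<exists>U\<in>T. \<forall>W\<in>spread. U \<inter> W = {0}"
    if "spread \<subset> T" "pairwise (\<lambda>U W. U \<inter> W = {0}) T" for T
  proof -
    from that(1) obtain U where "U \<in> T" "U \<notin> spread" by blast
    then show ?thesis using that unfolding pairwise_def by (intro bexI[of _ U]) (metis psubsetD)+
  qed
  have "maximal_orthogonal_partial_spread spread"
    unfolding maximal_orthogonal_partial_spread_def
  proof (intro conjI notI)
    show "orthogonal_partial_spread spread"
      using spread_subspace spread_Q spread_pairwise by (simp add: orthogonal_partial_spread_def)
    assume "\<exists>T. orthogonal_partial_spread T \<and> spread \<subset> T"
    then obtain T where T: "orthogonal_partial_spread T" "spread \<subset> T" by (elim exE conjE)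
    then have "pairwise (\<lambda>U W. U \<inter> W = {0}) T"
      unfolding orthogonal_partial_spread_def by (elim conjE)
    from proper[OF T(2) this] obtain U where "U \<in> T" and U: "\<forall>W\<in>spread. U \<inter> W = {0}"
      by (elim bexE)
    from \<open>U \<in> T\<close> have sU: "totally_singular U" "dim U = 4"
      using T(1) unfolding orthogonal_partial_spread_def totally_singular_def by simp_all
    then have "subspace U" and sing: "\<forall>u\<in>U. Q u = 0"
      unfolding totally_singular_def by simp_all
    obtain W where "W \<in> spread" "U \<inter> W \<noteq> {0}"
      by (rule spread_meets[OF \<open>subspace U\<close> sU(2) totally_singular_polar[OF sU(1)] disjI2[OF sing]])
    then show False using U by simp
  qed
  moreover have "maximal_symplectic_partial_spread spread" if "even q"
    unfolding maximal_symplectic_partial_spread_def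
  proof (intro conjI notI)
    show "symplectic_partial_spread spread"
      using spread_subspace spread_pairwise totally_singular_polar[OF spread_totally_singular]
      by (simp add: symplectic_partial_spread_def)
    \<comment> \<open>Characteristic two is the alternative under which \<open>spread_meets\<close>
      asks only that the polar form vanish on \<open>U\<close>.\<close>
    have 2: "(2::'k) = 0"
      using two_eq_0_of_even_card assms(1) that unfolding assms(2)[symmetric] .
    assume "\<exists>T. symplectic_partial_spread T \<and> spread \<subset> T"
    then obtain T where T: "symplectic_partial_spread T" "spread \<subset> T" by (elim exE conjE)
    then have "pairwise (\<lambda>U W. U \<inter> W = {0}) T"
      unfolding symplectic_partial_spread_def by (elim conjE)
    from proper[OF T(2) this] obtain U where "U \<in> T" and U: "\<forall>W\<in>spread. U \<inter> W = {0}"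
      by (elim bexE)
    from \<open>U \<in> T\<close> have sU: "subspace U" "dim U = 4" "\<And>u v. u \<in> U \<Longrightarrow> v \<in> U \<Longrightarrow> polar Q u v = 0"
      using T(1) unfolding symplectic_partial_spread_def by simp_all
    obtain W where "W \<in> spread" "U \<inter> W \<noteq> {0}"
      by (rule spread_meets[OF sU disjI1[OF 2]])
    then show False using U by simp
  qed
  ultimately show ?thesis
    using card_spread assms(2) by (intro exI[of _ spread]) simp
qed

end
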